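(* Let $K$ be a field and $n\ge 2$. Let $I\subset K[x,y]$ be an ideal minimally generated by $n$ monomials listed lexicographically, $$I=(x^{a_1},\, x^{a_2}y^{b_{n-1}},\ldots,x^{a_i}y^{b_{n-i+1}},\ldots, x^{a_{n-1}}y^{b_2},\, y^{b_1}),$$ where $a_1>a_2>\cdots>a_{n-1}>a_n:=0$ and $b_1>b_2>\cdots>b_{n-1}>b_n:=0$ are integers. If $a_i-a_{i+1}=1$ for $i=1,\ldots,n-1$ and $2b_{n-i}\le b_{n-i-1}+b_{n-i+1}$ for all $i$ with $1\le i\le n-2$, then $I$ is normal.
   Context: An ideal $I$ is normal if all its powers $I^m$, $m\ge1$, are integrally closed. *)

theory Defs
  imports "HOL-Algebra.Algebra" "HOL-Algebra.Algebraic_Closure_Type"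
begin

text \<open>
  An element \<open>r\<close> is integral over an ideal \<open>J\<close> if
  \<open>r^k + c\<^sub>1 r^(k-1) + \<dots> + c\<^sub>k = 0\<close> for some \<open>k \<ge> 1\<close> and
  \<open>c\<^sub>i \<in> J^i\<close>. The power \<open>J^i\<close> is taken in the semiring of ideals
  \<^term>\<open>ideals_set R\<close>, whose multiplication is \<^term>\<open>ideal_prod R\<close>.
\<close>

definition integral_over_ideal :: "('a, 'b) ring_scheme \<Rightarrow> 'a set \<Rightarrow> 'a \<Rightarrow> bool" where
  "integral_over_ideal R J r \<longleftrightarrow>
     (\<exists>k::nat. k \<ge> 1 \<and> (\<exists>c :: nat \<Rightarrow> 'a.
        (\<forall>i\<in>{1..k}. c i \<in> J [^]\<^bsub>ideals_set R\<^esub> i) \<and>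
        r [^]\<^bsub>R\<^esub> k \<oplus>\<^bsub>R\<^esub> (\<Oplus>\<^bsub>R\<^esub>i\<in>{1..k}. c i \<otimes>\<^bsub>R\<^esub> r [^]\<^bsub>R\<^esub> (k - i)) = \<zero>\<^bsub>R\<^esub>))"

definition ideal_integral_closure :: "('a, 'b) ring_scheme \<Rightarrow> 'a set \<Rightarrow> 'a set" where
  "ideal_integral_closure R J = {r \<in> carrier R. integral_over_ideal R J r}"

definition integrally_closed_ideal :: "'a set \<Rightarrow> ('a, 'b) ring_scheme \<Rightarrow> bool" where
  "integrally_closed_ideal J R \<longleftrightarrow> ideal J R \<and> ideal_integral_closure R J = J"

definition normal_ideal :: "'a set \<Rightarrow> ('a, 'b) ring_scheme \<Rightarrow> bool" where
  "normal_ideal I R \<longleftrightarrow>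
     ideal I R \<and> (\<forall>m::nat. m \<ge> 1 \<longrightarrow> integrally_closed_ideal (I [^]\<^bsub>ideals_set R\<^esub> m) R)"

definition minimally_generates :: "('a, 'b) ring_scheme \<Rightarrow> 'a set \<Rightarrow> 'a set \<Rightarrow> bool" where
  "minimally_generates R S I \<longleftrightarrow>
     S \<subseteq> carrier R \<and> I = Idl\<^bsub>R\<^esub> S \<and> (\<forall>T. T \<subset> S \<longrightarrow> Idl\<^bsub>R\<^esub> T \<noteq> I)"

text \<open>
  \<open>K[x,y]\<close> is rendered as \<open>K[x][y]\<close>: the inner polynomial variable is \<open>x\<close>, the outer one \<open>y\<close>.
\<close>

abbreviation poly_xy :: "'k::field poly poly ring" where
  "poly_xy \<equiv> ring_of_type_algebra"

definition var_x :: "'k::field poly poly" where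
  "var_x = [:[:0, 1:]:]"

definition var_y :: "'k::field poly poly" where
  "var_y = [:0, 1:]"

end

theory Submission
  imports Defs
begin

text \<open>
  Put \<open>d = n - 1\<close> and \<open>h j = b (j + 1)\<close>. As the exponents of \<open>x\<close> drop by one at a time, \<open>I\<close> is
  generated by the monomials \<open>x\<^sup>j y\<^bsup>h j\<^esup>\<close> for \<open>j \<le> d\<close>, where \<open>h\<close> is decreasing and convex with
  \<open>h d = 0\<close>. The polygonal line through the points \<open>(j, h j)\<close> is thus the lower boundary of the Newton
  polygon of \<open>I\<close>, and over every integer in \<open>[0, d]\<close> that boundary carries a generator.

  The edge between the abscissae \<open>q\<close> and \<open>q + 1\<close> has slope \<open>-s\<close> with \<open>s = h q - h (q + 1)\<close>, and it
  defines the monomial valuation in which \<open>x\<^sup>u y\<^sup>v\<close> has weight \<open>s u + v\<close>. On that edge the weight is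
  constant, say \<open>c\<close>, and by convexity all other generators have weight at least \<open>c\<close>. The proof
  shows that \<open>I\<^sup>m\<close> is exactly the set of polynomials whose weight for each of the \<open>d\<close> edges is at
  least \<open>m c\<close> (lemma \<open>convex_staircase_power\<close>). Such a set is integrally closed because the weight
  of a product is the sum of the weights (lemmas \<open>weight_ideal_power_exact\<close> and
  \<open>weight_ideal_integral\<close>).

  The step that uses consecutive exponents of \<open>x\<close> is the inclusion of these polynomials in \<open>I\<^sup>m\<close>.
  Given \<open>x\<^sup>u y\<^sup>v\<close> with \<open>u < m d\<close>, divide with remainder, \<open>u = q m + r\<close>. The inequality for the edge at
  \<open>q\<close> reads \<open>v \<ge> (m - r) h q + r h (q + 1)\<close>, which says that \<open>x\<^sup>u y\<^sup>v\<close> is a multiple of a product of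
  \<open>m - r\<close> copies of the generator at \<open>q\<close> and \<open>r\<close> copies of the one at \<open>q + 1\<close>. If \<open>u \<ge> m d\<close>, it
  is a multiple of the \<open>m\<close>-th power of the generator \<open>x\<^sup>d\<close>. So the lattice points of the \<open>m\<close>-fold
  dilated Newton polygon are all accounted for by products of \<open>m\<close> generators.
\<close>

section \<open>Monomial valuations on bivariate polynomials\<close>

text \<open>
  The valuation ideal of weight at least \<open>N\<close>, where \<open>x\<close> has weight \<open>s\<close> and \<open>y\<close> has weight \<open>1\<close>.
  As the outer variable is \<open>y\<close>, the coefficient of \<open>x\<^sup>u y\<^sup>v\<close> is \<open>coeff (coeff f v) u\<close>. Membership for
  varying \<open>N\<close> replaces the valuation itself, which would need a value at \<open>0\<close>.
\<close>

definition weight_ideal :: "nat \<Rightarrow> nat \<Rightarrow> 'a::idom poly poly set" where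
  "weight_ideal s N = {f. \<forall>u v. coeff (coeff f v) u \<noteq> 0 \<longrightarrow> N \<le> s * u + v}"

lemma weight_idealI:
  "(\<And>u v. coeff (coeff f v) u \<noteq> 0 \<Longrightarrow> N \<le> s * u + v) \<Longrightarrow> f \<in> weight_ideal s N"
  by (simp add: weight_ideal_def)

lemma weight_idealD:
  "f \<in> weight_ideal s N \<Longrightarrow> coeff (coeff f v) u \<noteq> 0 \<Longrightarrow> N \<le> s * u + v"
  by (simp add: weight_ideal_def)

lemma weight_ideal_0 [simp]: "weight_ideal s 0 = UNIV"
  by (simp add: weight_ideal_def)

lemma weight_ideal_zero_closed [simp]: "0 \<in> weight_ideal s N"
  by (simp add: weight_ideal_def)

lemma weight_ideal_antimono: "M \<le> N \<Longrightarrow> weight_ideal s N \<subseteq> weight_ideal s M"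
  by (auto simp: weight_ideal_def intro: order.trans)

lemma weight_ideal_uminus: "f \<in> weight_ideal s N \<Longrightarrow> - f \<in> weight_ideal s N"
  by (simp add: weight_ideal_def)

lemma weight_ideal_add:
  assumes "f \<in> weight_ideal s N" "g \<in> weight_ideal s N"
  shows "f + g \<in> weight_ideal s N"
proof (rule weight_idealI)
  fix u v assume "coeff (coeff (f + g) v) u \<noteq> 0"
  then have "coeff (coeff f v) u \<noteq> 0 \<or> coeff (coeff g v) u \<noteq> 0"
    by auto
  then show "N \<le> s * u + v"
    using assms by (auto dest: weight_idealD)
qed

lemma weight_ideal_sum:
  "(\<And>i. i \<in> A \<Longrightarrow> f i \<in> weight_ideal s N) \<Longrightarrow> (\<Sum>i\<in>A. f i) \<in> weight_ideal s N"
  by (induction A rule: infinite_finite_induct) (auto intro: weight_ideal_add)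

lemma coeff_coeff_mult:
  "coeff (coeff (f * g) v) u =
     (\<Sum>(i, j)\<in>{..v} \<times> {..u}. coeff (coeff f i) j * coeff (coeff g (v - i)) (u - j))"
  by (simp add: coeff_mult coeff_sum sum.cartesian_product)

lemma weight_ideal_mult:
  assumes "f \<in> weight_ideal s N" "g \<in> weight_ideal s M"
  shows "f * g \<in> weight_ideal s (N + M)"
proof (rule weight_idealI)
  fix u v assume "coeff (coeff (f * g) v) u \<noteq> 0"
  then obtain i j where ij: "i \<le> v" "j \<le> u"
    and nz: "coeff (coeff f i) j \<noteq> 0" "coeff (coeff g (v - i)) (u - j) \<noteq> 0"
    unfolding coeff_coeff_mult by (force elim!: sum.not_neutral_contains_not_neutral)
  have "N + M \<le> (s * j + i) + (s * (u - j) + (v - i))"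
    using assms nz by (intro add_mono weight_idealD)
  also have "\<dots> = s * (j + (u - j)) + (i + (v - i))"
    by (simp add: add_mult_distrib2 del: le_add_diff_inverse)
  also have "\<dots> = s * u + v"
    using ij by simp
  finally show "N + M \<le> s * u + v" .
qed

lemma weight_ideal_power: "f \<in> weight_ideal s N \<Longrightarrow> f ^ k \<in> weight_ideal s (k * N)"
  by (induction k) (auto dest: weight_ideal_mult)

lemma ex_lowest_monomial:
  assumes "f \<in> weight_ideal s N" "f \<notin> weight_ideal s (Suc N)"
  obtains u v where "coeff (coeff f v) u \<noteq> 0" "s * u + v = N"
    "\<And>u' v'. coeff (coeff f v') u' \<noteq> 0 \<Longrightarrow> s * u' + v' = N \<Longrightarrow> u \<le> u'"
proof -
  let ?P = "\<lambda>u. \<exists>v. coeff (coeff f v) u \<noteq> 0 \<and> s * u + v = N"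
  from assms(2) obtain u0 v0 where "coeff (coeff f v0) u0 \<noteq> 0" "\<not> Suc N \<le> s * u0 + v0"
    by (auto simp: weight_ideal_def)
  then have "?P u0"
    using weight_idealD[OF assms(1)] by (metis le_antisym not_less_eq_eq)
  then have "?P (LEAST u. ?P u)"
    by (rule LeastI)
  then obtain v where "coeff (coeff f v) (LEAST u. ?P u) \<noteq> 0" "s * (LEAST u. ?P u) + v = N"
    by blast
  then show ?thesis
    by (rule that) (rule Least_le, blast)
qed

text \<open>
  Additivity of the weight. Among the monomials of least weight of each factor take the one with
  the smallest exponent of \<open>x\<close>. Their product cannot cancel: every other pair of monomials with the
  same product would have one member of smaller weight, or of equal weight and smaller exponent.
\<close>

lemma weight_ideal_mult_exact:
  assumes f: "f \<in> weight_ideal s N" "f \<notin> weight_ideal s (Suc N)"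
    and g: "g \<in> weight_ideal s M" "g \<notin> weight_ideal s (Suc M)"
  shows "f * g \<notin> weight_ideal s (Suc (N + M))"
proof
  assume fg: "f * g \<in> weight_ideal s (Suc (N + M))"
  from f obtain u v where uv: "coeff (coeff f v) u \<noteq> 0" "s * u + v = N"
    and uv_least: "\<And>u' v'. coeff (coeff f v') u' \<noteq> 0 \<Longrightarrow> s * u' + v' = N \<Longrightarrow> u \<le> u'"
    by (rule ex_lowest_monomial) blast
  from g obtain p q where pq: "coeff (coeff g q) p \<noteq> 0" "s * p + q = M"
    and pq_least: "\<And>u' v'. coeff (coeff g v') u' \<noteq> 0 \<Longrightarrow> s * u' + v' = M \<Longrightarrow> p \<le> u'"
    by (rule ex_lowest_monomial) blast
  let ?t = "\<lambda>(i, j). coeff (coeff f i) j * coeff (coeff g (v + q - i)) (u + p - j)"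
  have other: "?t ij = 0" if ij: "ij \<in> {..v + q} \<times> {..u + p} - {(v, u)}" for ij
  proof (rule ccontr)
    assume nz: "?t ij \<noteq> 0"
    obtain i j where ij_eq: "ij = (i, j)" by (cases ij)
    define i' j' where "i' = v + q - i" and "j' = u + p - j"
    have split: "v + q = i + i'" "u + p = j + j'"
      using ij by (auto simp: ij_eq i'_def j'_def)
    have nz': "coeff (coeff f i) j \<noteq> 0" "coeff (coeff g i') j' \<noteq> 0"
      using nz by (auto simp: ij_eq i'_def j'_def)
    have "N \<le> s * j + i" "M \<le> s * j' + i'"
      using weight_idealD[OF f(1) nz'(1)] weight_idealD[OF g(1) nz'(2)] .
    moreover have "(s * j + i) + (s * j' + i') = s * (j + j') + (i + i')"
      by (simp add: algebra_simps)
    moreover have "\<dots> = N + M"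
      unfolding split[symmetric] uv(2)[symmetric] pq(2)[symmetric] by (simp add: algebra_simps)
    ultimately have eq: "s * j + i = N" "s * j' + i' = M"
      by linarith+
    have "u \<le> j" "p \<le> j'"
      using uv_least[OF nz'(1) eq(1)] pq_least[OF nz'(2) eq(2)] .
    with split have "j = u"
      by linarith
    with eq(1) uv(2) have "i = v"
      by simp
    with \<open>j = u\<close> ij ij_eq show False
      by simp
  qed
  have "coeff (coeff (f * g) (v + q)) (u + p) = ?t (v, u)"
    unfolding coeff_coeff_mult using other
    by (subst sum.remove[of _ "(v, u)"]) (auto intro!: sum.neutral)
  then have "coeff (coeff (f * g) (v + q)) (u + p) \<noteq> 0"
    using uv(1) pq(1) by simp
  then have "Suc (N + M) \<le> s * (u + p) + (v + q)"
    by (rule weight_idealD[OF fg])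
  with uv(2) pq(2) show False
    by (simp add: algebra_simps)
qed

lemma weight_ideal_power_exact:
  assumes "f \<in> weight_ideal s N" "f \<notin> weight_ideal s (Suc N)"
  shows "f ^ k \<notin> weight_ideal s (Suc (k * N))"
proof (induction k)
  case 0
  have "coeff (coeff (1 :: 'a poly poly) 0) 0 \<noteq> 0" by simp
  then show ?case
    using weight_idealD[of "1 :: 'a poly poly" s "Suc 0" 0 0] by fastforce
next
  case (Suc k)
  then show ?case
    using weight_ideal_mult_exact[OF assms weight_ideal_power[OF assms(1)], of k] by simp
qed

section \<open>Ideal powers in a ring given by its type\<close>

lemma type_ring_simps [simp]:
  "carrier ring_of_type_algebra = UNIV"
  "f \<otimes>\<^bsub>ring_of_type_algebra\<^esub> g = f * g"
  "f \<oplus>\<^bsub>ring_of_type_algebra\<^esub> g = f + g"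
  "\<zero>\<^bsub>ring_of_type_algebra\<^esub> = 0"
  "\<one>\<^bsub>ring_of_type_algebra\<^esub> = 1"
  by (simp_all add: ring_of_type_algebra_def)

lemma type_ring_pow [simp]: "f [^]\<^bsub>ring_of_type_algebra\<^esub> (k::nat) = f ^ k"
  by (induction k) (simp_all add: nat_pow_def power_commutes)

lemma type_ring_finsum:
  fixes f :: "'b \<Rightarrow> 'a::comm_ring_1"
  assumes "finite A"
  shows "(\<Oplus>\<^bsub>ring_of_type_algebra\<^esub>i\<in>A. f i) = (\<Sum>i\<in>A. f i)"
proof -
  interpret cring "ring_of_type_algebra :: 'a ring"
    by (rule cring_from_type_algebra)
  show ?thesis
    using assms by (induction A rule: finite_induct) simp_all
qed

lemma type_ring_uminus: "\<ominus>\<^bsub>ring_of_type_algebra\<^esub> f = - (f :: 'a::comm_ring_1)"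
proof -
  interpret cring "ring_of_type_algebra :: 'a ring"
    by (rule cring_from_type_algebra)
  show ?thesis
    by (rule minus_equality) simp_all
qed

lemma type_ring_ideal_closed:
  assumes "ideal J (ring_of_type_algebra :: 'a::comm_ring_1 ring)"
  shows "0 \<in> J"
    and "f \<in> J \<Longrightarrow> g \<in> J \<Longrightarrow> f + g \<in> J"
    and "f \<in> J \<Longrightarrow> - f \<in> J"
    and "f \<in> J \<Longrightarrow> g * f \<in> J"
  using additive_subgroup.zero_closed[OF ideal.axioms(1)[OF assms]]
    additive_subgroup.a_closed[OF ideal.axioms(1)[OF assms], of f g]
    additive_subgroup.a_inv_closed[OF ideal.axioms(1)[OF assms], of f]
    ideal.I_l_closed[OF assms, of f g]
  by (simp_all add: type_ring_uminus)

lemma type_ring_ideal_sum: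
  assumes J: "ideal J (ring_of_type_algebra :: 'a::comm_ring_1 ring)"
    and f: "\<And>i. i \<in> A \<Longrightarrow> f i \<in> J"
  shows "(\<Sum>i\<in>A. f i) \<in> J"
  using f
  by (induction A rule: infinite_finite_induct) (simp_all add: type_ring_ideal_closed[OF J])

lemma ideals_set_simps [simp]:
  "\<one>\<^bsub>ideals_set R\<^esub> = carrier R"
  "I \<otimes>\<^bsub>ideals_set R\<^esub> J = ideal_prod R I J"
  by (simp_all add: ideals_set_def)

lemma ideal_power_0: "I [^]\<^bsub>ideals_set R\<^esub> (0::nat) = carrier R"
  by (simp add: nat_pow_def)

lemma ideal_power_Suc:
  "I [^]\<^bsub>ideals_set R\<^esub> Suc m = ideal_prod R (I [^]\<^bsub>ideals_set R\<^esub> m) I"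
  by (simp add: nat_pow_def)

lemma ideal_power_is_ideal:
  fixes m :: nat
  assumes "ideal I R"
  shows "ideal (I [^]\<^bsub>ideals_set R\<^esub> m) R"
proof -
  interpret ring R
    using assms by (rule ideal.axioms(2))
  show ?thesis
    by (induction m) (simp_all add: ideal_power_0 ideal_power_Suc oneideal ideal_prod_is_ideal assms)
qed

section \<open>Integral elements have large weight\<close>

lemma ideal_weight_ideal: "ideal (weight_ideal s N) (ring_of_type_algebra :: 'a::idom poly poly ring)"
proof -
  have mult: "g * f \<in> weight_ideal s N" if "f \<in> weight_ideal s N" for f g :: "'a poly poly"
    using weight_ideal_mult[of g s 0 f N] that by simp
  show ?thesis
  proof (rule idealI)
    show "subgroup (weight_ideal s N) (add_monoid (ring_of_type_algebra :: 'a poly poly ring))"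
    proof (rule subgroup.intro)
      fix f :: "'a poly poly"
      assume "f \<in> weight_ideal s N"
      then have "\<ominus>\<^bsub>ring_of_type_algebra\<^esub> f \<in> weight_ideal s N"
        by (simp only: type_ring_uminus weight_ideal_uminus)
      then show "inv\<^bsub>add_monoid ring_of_type_algebra\<^esub> f \<in> weight_ideal s N"
        by (simp only: a_inv_def)
    qed (auto simp: weight_ideal_add)
  qed (use mult in \<open>auto simp: mult.commute intro: ring_from_type_algebra\<close>)
qed

lemma ideal_power_subset_weight_ideal:
  fixes J :: "'a::idom poly poly set"
  assumes "J \<subseteq> weight_ideal s N"
  shows "J [^]\<^bsub>ideals_set ring_of_type_algebra\<^esub> m \<subseteq> weight_ideal s (m * N)"
proof (induction m)
  case 0
  then show ?case by simp
next
  case (Suc m)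
  show ?case
  proof
    fix f assume "f \<in> J [^]\<^bsub>ideals_set ring_of_type_algebra\<^esub> Suc m"
    then have "f \<in> ideal_prod ring_of_type_algebra (J [^]\<^bsub>ideals_set ring_of_type_algebra\<^esub> m) J"
      by (simp only: ideal_power_Suc)
    then show "f \<in> weight_ideal s (Suc m * N)"
    proof induction
      case (prod i j)
      then have "i * j \<in> weight_ideal s (m * N + N)"
        using Suc.IH assms by (intro weight_ideal_mult) auto
      then show ?case by (simp add: add.commute)
    next
      case (sum f g)
      then show ?case by (simp add: weight_ideal_add)
    qed
  qed
qed

text \<open>
  If \<open>r\<close> had weight \<open>e < N\<close>, then \<open>r\<^sup>k\<close> would have weight exactly \<open>k e\<close>, whereas all other terms
  \<open>c\<^sub>i r\<^bsup>k - i\<^esup>\<close> of an equation of integral dependence have weight at least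
  \<open>i N + (k - i) e > k e\<close>, as \<open>i \<ge> 1\<close>.
\<close>

lemma weight_ideal_integral:
  fixes J :: "'a::idom poly poly set"
  assumes J: "J \<subseteq> weight_ideal s N"
    and r: "integral_over_ideal ring_of_type_algebra J r"
  shows "r \<in> weight_ideal s N"
proof (rule ccontr)
  assume "r \<notin> weight_ideal s N"
  then obtain e where e: "e < N" "r \<in> weight_ideal s e" "r \<notin> weight_ideal s (Suc e)"
    using ex_least_nat_less[of "\<lambda>e. r \<notin> weight_ideal s e" N] by auto
  have "\<exists>k\<ge>1. \<exists>c. (\<forall>i\<in>{1..k}. c i \<in> J [^]\<^bsub>ideals_set ring_of_type_algebra\<^esub> i) \<and>
      r ^ k + (\<Sum>i\<in>{1..k}. c i * r ^ (k - i)) = 0"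
    using r by (simp add: integral_over_ideal_def type_ring_finsum)
  then obtain k c where k: "k \<ge> 1"
    and c: "\<And>i. i \<in> {1..k} \<Longrightarrow> c i \<in> J [^]\<^bsub>ideals_set ring_of_type_algebra\<^esub> i"
    and eq: "r ^ k + (\<Sum>i\<in>{1..k}. c i * r ^ (k - i)) = 0"
    by blast
  have "c i * r ^ (k - i) \<in> weight_ideal s (Suc (k * e))" if i: "i \<in> {1..k}" for i
  proof -
    have "c i * r ^ (k - i) \<in> weight_ideal s (i * N + (k - i) * e)"
      using c[OF i] ideal_power_subset_weight_ideal[OF J] e(2)
      by (intro weight_ideal_mult weight_ideal_power) auto
    moreover have "Suc (k * e) \<le> i * N + (k - i) * e"
    proof -
      have "k * e = i * e + (k - i) * e"
        using i by (simp flip: add_mult_distrib)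
      moreover have "i * e < i * N"
        using i e(1) by simp
      ultimately show ?thesis by linarith
    qed
    ultimately show ?thesis
      using weight_ideal_antimono by blast
  qed
  then have "- (\<Sum>i\<in>{1..k}. c i * r ^ (k - i)) \<in> weight_ideal s (Suc (k * e))"
    by (intro weight_ideal_uminus weight_ideal_sum)
  moreover have "r ^ k = - (\<Sum>i\<in>{1..k}. c i * r ^ (k - i))"
    using eq by (rule eq_neg_iff_add_eq_0[THEN iffD2])
  ultimately show False
    using weight_ideal_power_exact[OF e(2,3), of k] by simp
qed

section \<open>Powers of an ideal generated by a convex staircase of monomials\<close>

lemma var_monomial: "var_x ^ u * var_y ^ v = (monom (monom 1 u) v :: 'a::field poly poly)"
proof -
  have "var_x ^ u = [:monom 1 u :: 'a poly:]"
    by (induction u) (simp_all add: var_x_def monom_Suc one_pCons monom_0)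
  moreover have "var_y ^ v = (monom 1 v :: 'a poly poly)"
    by (simp add: var_y_def monom_altdef)
  ultimately show ?thesis
    by (simp add: smult_monom)
qed

lemma coeff_var_monomial_ne_0:
  "coeff (coeff (var_x ^ i * var_y ^ j) v) u \<noteq> 0 \<longleftrightarrow> u = i \<and> v = j"
  by (auto simp: var_monomial)

lemma sum_of_var_monomials:
  fixes f :: "'k::field poly poly"
  shows "f = (\<Sum>v\<le>degree f. \<Sum>u\<le>degree (coeff f v).
           [:[:coeff (coeff f v) u:]:] * (var_x ^ u * var_y ^ v))"
proof -
  have "(\<Sum>u\<le>degree p. [:[:coeff p u:]:] * (var_x ^ u * var_y ^ v)) = monom p v"
    for p :: "'k poly" and v
  proof -
    have "(\<Sum>u\<le>degree p. [:[:coeff p u:]:] * (var_x ^ u * var_y ^ v))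
        = (\<Sum>u\<le>degree p. monom (monom (coeff p u) u) v)"
      by (simp add: var_monomial smult_monom)
    also have "\<dots> = monom (\<Sum>u\<le>degree p. monom (coeff p u) u) v"
      by (rule poly_eqI) (simp add: coeff_sum)
    finally show ?thesis
      by (simp add: poly_as_sum_of_monoms)
  qed
  then show ?thesis
    by (simp add: poly_as_sum_of_monoms)
qed

text \<open>
  By convexity \<open>h\<close> drops by at least \<open>s\<close> in each step to the left of \<open>q\<close> and by at most \<open>s\<close> in each
  step to the right of it. So \<open>s j + h j\<close> does not grow up to \<open>j = q\<close> and does not shrink from there.
\<close>

lemma convex_above_edge:
  fixes h :: "nat \<Rightarrow> nat"
  assumes decr: "\<And>j. j < d \<Longrightarrow> h (Suc j) \<le> h j"
    and convex: "\<And>j. Suc j < d \<Longrightarrow> 2 * h (Suc j) \<le> h j + h (Suc (Suc j))"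
    and q: "q < d" and j: "j \<le> d"
  defines "s \<equiv> h q - h (Suc q)"
  shows "s * q + h q \<le> s * j + h j"
proof -
  have flatter: "h i - h (Suc i) \<le> h l - h (Suc l)" if "l \<le> i" "i < d" for l i
    using that
  proof (induction i rule: dec_induct)
    case (step i)
    then show ?case using convex[of i] decr[of i] decr[of "Suc i"] by simp
  qed simp
  show ?thesis
  proof (cases "q \<le> j")
    case True
    then show ?thesis using j
    proof (induction j rule: dec_induct)
      case (step i)
      then show ?case
        using flatter[of q i] decr[of i] by (simp add: s_def)
    qed simp
  next
    case False
    then have "j \<le> q" by simp
    then show ?thesis
    proof (induction j rule: inc_induct)
      case (step i)
      then show ?case
        using flatter[of i q] decr[of i] q by (simp add: s_def)
    qed simp
  qed
qed

lemma ideal_power_mult_power: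
  fixes I :: "'a::comm_ring_1 set"
  assumes "p \<in> I [^]\<^bsub>ideals_set ring_of_type_algebra\<^esub> k" "g \<in> I"
  shows "p * g ^ l \<in> I [^]\<^bsub>ideals_set ring_of_type_algebra\<^esub> (k + l)"
proof (induction l)
  case (Suc l)
  then show ?case
    using ideal_prod.prod[OF Suc.IH assms(2), of ring_of_type_algebra]
    by (simp add: ideal_power_Suc mult_ac)
qed (use assms in simp)

text \<open>
  The inequality for the edge at \<open>q = u div m\<close> suffices: over \<open>[m q, m (q + 1)]\<close> that edge, dilated
  by \<open>m\<close>, is the boundary of the dilated Newton polygon, and its lattice abscissa \<open>m q + r\<close> is
  reached by \<open>m - r\<close> generators from the left end and \<open>r\<close> from the right end. For \<open>u \<ge> m d\<close> there is
  no such edge, but then already \<open>(x\<^sup>d)\<^sup>m\<close> divides the monomial.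
\<close>

lemma convex_staircase_monomial_in_power:
  fixes I :: "'k::field poly poly set"
  assumes I: "ideal I poly_xy"
    and gens: "\<And>j. j \<le> d \<Longrightarrow> var_x ^ j * var_y ^ h j \<in> I"
    and decr: "\<And>j. j < d \<Longrightarrow> h (Suc j) \<le> h j" and h_d: "h d = 0"
    and weight: "\<And>q. q < d \<Longrightarrow>
      m * ((h q - h (Suc q)) * q + h q) \<le> (h q - h (Suc q)) * u + v"
  shows "var_x ^ u * var_y ^ v \<in> I [^]\<^bsub>ideals_set poly_xy\<^esub> m"
proof -
  \<comment> \<open>A product of \<open>k + l\<close> generators taken at two abscissae, together with its multiples.\<close>
  have *: "var_x ^ u * var_y ^ v \<in> I [^]\<^bsub>ideals_set poly_xy\<^esub> (k + l)"
    if "i \<le> d" "j \<le> d" "k * i + l * j \<le> u" "k * h i + l * h j \<le> v" for i j k l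
  proof -
    let ?p = "(var_x ^ i * var_y ^ h i) ^ k * (var_x ^ j * var_y ^ h j) ^ l :: 'k poly poly"
    let ?c = "var_x ^ (u - (k * i + l * j)) * var_y ^ (v - (k * h i + l * h j)) :: 'k poly poly"
    have "1 * (var_x ^ i * var_y ^ h i) ^ k \<in> I [^]\<^bsub>ideals_set poly_xy\<^esub> (0 + k)"
      using gens[OF that(1)] by (intro ideal_power_mult_power) (simp_all add: ideal_power_0)
    then have "?p \<in> I [^]\<^bsub>ideals_set poly_xy\<^esub> (k + l)"
      using gens[OF that(2)] by (intro ideal_power_mult_power) simp_all
    then have "?c * ?p \<in> I [^]\<^bsub>ideals_set poly_xy\<^esub> (k + l)"
      by (rule type_ring_ideal_closed(4)[OF ideal_power_is_ideal[OF I]])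
    also have "?c * ?p = var_x ^ ((u - (k * i + l * j)) + (k * i + l * j)) *
                         var_y ^ ((v - (k * h i + l * h j)) + (k * h i + l * h j))"
      by (simp add: power_add power_mult_distrib mult_ac flip: power_mult)
    finally show ?thesis
      using that by simp
  qed
  show ?thesis
  proof (cases "m * d \<le> u")
    case True
    then show ?thesis
      using *[of d d m 0] h_d by simp
  next
    case False
    define q r where "q = u div m" and "r = u mod m"
    have u: "u = m * q + r" and r: "r < m"
      using False by (cases "m = 0"; simp add: q_def r_def)+
    have q: "q < d"
      using False u by (metis le_add1 mult_le_mono2 not_le order.trans)
    obtain s where s: "h q = h (Suc q) + s"
      using decr[OF q] le_Suc_ex by blast
    obtain k where k: "m = k + r"
      using r less_imp_add_positive by (metis add.commute)
    have "m * (s * q + h q) \<le> s * u + v"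
      using weight[OF q] s by simp
    then have "m * h q \<le> s * r + v"
      by (simp add: u algebra_simps)
    then have "k * h q + r * h (Suc q) \<le> v"
      by (simp add: s k algebra_simps)
    moreover have "k * q + r * Suc q \<le> u"
      by (simp add: u k algebra_simps)
    ultimately show ?thesis
      using *[of q "Suc q" k r] q k by simp
  qed
qed

lemma convex_staircase_power:
  fixes I :: "'k::field poly poly set"
  assumes I: "I = Idl\<^bsub>poly_xy\<^esub> {var_x ^ j * var_y ^ h j | j. j \<le> d}"
    and decr: "\<And>j. j < d \<Longrightarrow> h (Suc j) \<le> h j" and h_d: "h d = 0"
    and convex: "\<And>j. Suc j < d \<Longrightarrow> 2 * h (Suc j) \<le> h j + h (Suc (Suc j))"
  shows "I [^]\<^bsub>ideals_set poly_xy\<^esub> m =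
    (\<Inter>q<d. weight_ideal (h q - h (Suc q)) (m * ((h q - h (Suc q)) * q + h q)))"
proof (intro equalityI subsetI INT_I)
  have ring: "ring (poly_xy :: 'k poly poly ring)"
    by (rule ring_from_type_algebra)
  fix f :: "'k poly poly" and q assume f: "f \<in> I [^]\<^bsub>ideals_set poly_xy\<^esub> m" and q: "q \<in> {..<d}"
  let ?s = "h q - h (Suc q)"
  have "{var_x ^ j * var_y ^ h j | j. j \<le> d} \<subseteq> weight_ideal ?s (?s * q + h q)"
    using convex_above_edge[of d h q, OF decr convex] q
    by (auto simp: coeff_var_monomial_ne_0 intro!: weight_idealI)
  then have "I \<subseteq> weight_ideal ?s (?s * q + h q)"
    unfolding I by (intro ring.genideal_minimal[OF ring] ideal_weight_ideal)
  with f show "f \<in> weight_ideal ?s (m * (?s * q + h q))"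
    using ideal_power_subset_weight_ideal by blast
next
  have ring: "ring (poly_xy :: 'k poly poly ring)"
    by (rule ring_from_type_algebra)
  fix f :: "'k poly poly"
  assume f: "f \<in> (\<Inter>q<d. weight_ideal (h q - h (Suc q)) (m * ((h q - h (Suc q)) * q + h q)))"
  let ?J = "I [^]\<^bsub>ideals_set poly_xy\<^esub> m"
  have I_ideal: "ideal I poly_xy"
    unfolding I by (rule ring.genideal_ideal[OF ring]) simp
  have gens: "var_x ^ j * var_y ^ h j \<in> I" if "j \<le> d" for j
    using ring.genideal_self[OF ring, of "{var_x ^ j * var_y ^ h j | j. j \<le> d}"] that
    unfolding I by auto
  have J: "ideal ?J poly_xy"
    using I_ideal by (rule ideal_power_is_ideal)
  have "[:[:coeff (coeff f v) u:]:] * (var_x ^ u * var_y ^ v) \<in> ?J" for u v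
  proof (cases "coeff (coeff f v) u = 0")
    case True
    then show ?thesis using type_ring_ideal_closed(1)[OF J] by simp
  next
    case False
    have "var_x ^ u * var_y ^ v \<in> ?J"
    proof (rule convex_staircase_monomial_in_power[OF I_ideal gens decr h_d])
      fix q assume "q < d"
      with f have "f \<in> weight_ideal (h q - h (Suc q)) (m * ((h q - h (Suc q)) * q + h q))"
        by blast
      then show "m * ((h q - h (Suc q)) * q + h q) \<le> (h q - h (Suc q)) * u + v"
        using False by (rule weight_idealD)
    qed
    then show ?thesis
      by (rule type_ring_ideal_closed(4)[OF J])
  qed
  then show "f \<in> ?J"
    by (subst sum_of_var_monomials) (intro type_ring_ideal_sum J)
qed

theorem proposition2p15:
  fixes I :: "'k::field poly poly set"
    and n :: nat
    and a b :: "nat \<Rightarrow> nat"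
  assumes "n \<ge> 2"
    and "\<forall>i\<in>{1..n-1}. a i > a (i + 1)" and "a n = 0"
    and "\<forall>i\<in>{1..n-1}. b i > b (i + 1)" and "b n = 0"
    and "minimally_generates poly_xy {var_x ^ a i * var_y ^ b (n - i + 1) | i. i \<in> {1..n}} I"
    and "\<forall>i\<in>{1..n-1}. a i - a (i + 1) = 1"
    and "\<forall>i. 1 \<le> i \<and> i \<le> n - 2 \<longrightarrow> 2 * b (n - i) \<le> b (n - i - 1) + b (n - i + 1)"
  shows "normal_ideal I poly_xy"
proof -
  have ring: "ring (poly_xy :: 'k poly poly ring)"
    by (rule ring_from_type_algebra)
  define d where "d = n - 1"
  define h where "h = (\<lambda>j. b (Suc j))"
  have a: "a (n - j) = j" if "j \<le> d" for j
    using that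
  proof (induction j)
    case 0
    then show ?case using assms(3) by simp
  next
    case (Suc j)
    then have i: "n - Suc j \<in> {1..n-1}" "n - Suc j + 1 = n - j"
      using assms(1) by (auto simp: d_def)
    then have "a (n - Suc j) > a (n - j)" "a (n - Suc j) - a (n - j) = 1"
      using assms(2,7) by metis+
    with Suc show ?case by simp
  qed
  have "{var_x ^ a i * var_y ^ b (n - i + 1) | i. i \<in> {1..n}}
      = {var_x ^ j * var_y ^ h j :: 'k poly poly | j. j \<le> d}" (is "?L = ?R")
  proof (intro equalityI subsetI)
    fix f assume "f \<in> ?L"
    then obtain i where i: "i \<in> {1..n}" "f = var_x ^ a i * var_y ^ b (n - i + 1)"
      by blast
    then have "n - i \<le> d" "f = var_x ^ (n - i) * var_y ^ h (n - i)"
      using a[of "n - i"] by (auto simp: h_def d_def)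
    then show "f \<in> ?R" by blast
  next
    fix f assume "f \<in> ?R"
    then obtain j where j: "j \<le> d" "f = var_x ^ j * var_y ^ h j"
      by blast
    then have "n - j \<in> {1..n}" "f = var_x ^ a (n - j) * var_y ^ b (n - (n - j) + 1)"
      using a[of j] assms(1) by (auto simp: h_def d_def)
    then show "f \<in> ?L" by blast
  qed
  with assms(6) have I: "I = Idl\<^bsub>poly_xy\<^esub> {var_x ^ j * var_y ^ h j | j. j \<le> d}"
    by (simp add: minimally_generates_def)
  have decr: "h (Suc j) \<le> h j" if "j < d" for j
    using assms(4) that by (auto simp: h_def d_def less_imp_le)
  have h_d: "h d = 0"
    using assms(1,5) by (simp add: h_def d_def)
  have convex: "2 * h (Suc j) \<le> h j + h (Suc (Suc j))" if "Suc j < d" for j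
  proof -
    define i where "i = n - Suc (Suc j)"
    have "1 \<le> i" "i \<le> n - 2" "n - i = Suc (Suc j)"
      using that by (auto simp: i_def d_def)
    then show ?thesis
      using assms(8)[rule_format, of i] by (simp add: h_def)
  qed
  have ideal_I: "ideal I poly_xy"
    unfolding I by (rule ring.genideal_ideal[OF ring]) simp
  show ?thesis
    unfolding normal_ideal_def integrally_closed_ideal_def ideal_integral_closure_def
  proof (intro conjI allI impI ideal_I ideal_power_is_ideal equalityI subsetI)
    fix m :: nat and r :: "'k poly poly"
    let ?J = "I [^]\<^bsub>ideals_set poly_xy\<^esub> m"
    note J = convex_staircase_power[OF I decr h_d convex, of m]
    {
      assume "r \<in> {r \<in> carrier poly_xy. integral_over_ideal poly_xy ?J r}"
      then have r: "integral_over_ideal poly_xy ?J r"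
        by simp
      have "r \<in> weight_ideal (h q - h (Suc q)) (m * ((h q - h (Suc q)) * q + h q))"
        if "q < d" for q
        using that by (intro weight_ideal_integral[OF _ r]) (auto simp: J)
      then show "r \<in> ?J"
        by (auto simp: J)
    next
      assume r: "r \<in> ?J"
      \<comment> \<open>An element \<open>r\<close> of the ideal satisfies the equation \<open>r + (- r) = 0\<close> of degree one.\<close>
      have "- r \<in> ?J"
        using ideal_power_is_ideal[OF ideal_I] r by (rule type_ring_ideal_closed(3))
      then have "- r \<in> ?J [^]\<^bsub>ideals_set poly_xy\<^esub> (1::nat)"
        using ideal_prod.prod[of 1 UNIV "- r" ?J poly_xy]
        by (simp add: ideal_power_0 ideal_power_Suc)
      then have "integral_over_ideal poly_xy ?J r"
        unfolding integral_over_ideal_def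
        by (intro exI[of _ 1] conjI exI[of _ "\<lambda>_. - r"]) (auto simp: type_ring_finsum)
      then show "r \<in> {r \<in> carrier poly_xy. integral_over_ideal poly_xy ?J r}"
        by simp
    }
  qed
qed

end
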